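(* Let $\xi=(\xi(\tau))_{\tau\in\Theta}$ be a $p$-integrable admissible family and let $V=(V(\nu))_{\nu\in\Theta}$, $V(\nu)=\operatorname{ess\,sup}_{\tau\in\Theta_\nu}\rho_{\nu,\tau}[\xi(\tau)]$, be its value family. Assume that $V(\nu)\in L^p$ for every $\nu\in\Theta$. 1. If $\rho$ satisfies admissibility, consistency, the generalized zero-one law and the monotone Fatou property with respect to the terminal condition, then $V$ is a $(\Theta,\rho)$-supermartingale family. 2. If, moreover, $\rho$ satisfies knowledge preservation and monotonicity, then $V$ is equal to the $(\Theta,\rho)$-Snell envelope of $\xi$, that is, $V$ is the smallest $(\Theta,\rho)$-supermartingale family dominating $\xi$.
   Context: Setting. $T>0$ is fixed; $(\Omega,\mathcal F,P)$ is a complete probability space with a right-continuous complete filtration $(\mathcal F_t)_{t\in[0,T]}$. Equalities and inequalities between random variables (and between measurable sets) are understood $P$-a.s. $\mathbb N=\{0,1,2,\dots\}$. $(\theta_k)_{k\in\mathbb N}$ is a sequence of stopping times with $\theta_0=0$, $\theta_k\le\theta_{k+1}$ a.s. for all $k$, and $\lim_{k}\theta_k=T$ a.s. $\Theta$ is the set of stopping times of the form $\tau=\sum_{k=0}^{\infty}\theta_k\mathbf 1_{A_k}+T\mathbf 1_{\bar A}$, where $\{(A_k)_{k\in\mathbb N},\bar A\}$ is a partition of $\Omega$ with $A_k\in\mathcal F_{\theta_k}$ for each $k$ and $\bar A\in\mathcal F_T$. For $\tau\in\Theta$, $\Theta_\tau=\{\nu\in\Theta:\nu\ge\tau \text{ a.s.}\}$.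 $p\in[1,+\infty]$ is fixed. Families. A family $\phi=(\phi(\tau))_{\tau\in\Theta}$ is admissible if each $\phi(\tau)$ is a real-valued $\mathcal F_\tau$-measurable random variable and $\phi(\tau)=\phi(\tau')$ a.s. on $\{\tau=\tau'\}$ for all $\tau,\tau'\in\Theta$; it is $p$-integrable if $\phi(\tau)\in L^p$ for all $\tau\in\Theta$. $\phi$ dominates (resp. equals) $\phi'$ if $\phi(\tau)\ge\phi'(\tau)$ (resp. $\phi(\tau)=\phi'(\tau)$) a.s. for all $\tau\in\Theta$. Operators. $\rho=(\rho_{S,\tau})_{S,\tau\in\Theta}$ is a family of (possibly non-linear) operators $\rho_{S,\tau}:L^p(\mathcal F_\tau)\to L^p(\mathcal F_S)$. Properties: - admissibility: $\rho_{S,\tau}[\eta]=\rho_{S',\tau}[\eta]$ a.s. on $\{S=S'\}$, for $S,S',\tau\in\Theta$, $\eta\in L^p(\mathcal F_\tau)$; - knowledge preservation: $\rho_{\tau,S}[\eta]=\eta$ for all $S\in\Theta$, $\tau\in\Theta_S$, $\eta\in L^p(\mathcal F_S)$; - monotonicity: $\rho_{S,\tau}[\eta_1]\le\rho_{S,\tau}[\eta_2]$ a.s. whenever $\eta_1\le\eta_2$ a.s., $\eta_1,\eta_2\in L^p(\mathcal F_\tau)$; - consistency: $\rho_{S,\theta}[\rho_{\theta,\tau}[\eta]]=\rho_{S,\tau}[\eta]$ for all $S,\theta,\tau\in\Theta$ with $S\le\theta\le\tau$ a.s. and $\eta\in L^p(\mathcal F_\tau)$; - generalized zero-one law: $\mathbf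 1_A\rho_{S,\tau}[\zeta(\tau)]=\mathbf 1_A\rho_{S,\tau'}[\zeta(\tau')]$ for every $p$-integrable admissible family $\zeta$, $S\in\Theta$, $A\in\mathcal F_S$, and $\tau,\tau'\in\Theta_S$ with $\tau=\tau'$ on $A$; - monotone Fatou property with respect to the terminal condition: $\rho_{S,\tau}[\eta]\le\liminf_n\rho_{S,\tau}[\eta_n]$ whenever $(\eta_n)\subset L^p(\mathcal F_\tau)$ is non-decreasing, $\sup_n\eta_n\in L^p$ and $\lim_n\eta_n=\eta$ a.s. A $p$-integrable admissible family $\phi$ is a $(\Theta,\rho)$-supermartingale family if $\rho_{\sigma,\tau}[\phi(\tau)]\le\phi(\sigma)$ a.s. for all $\sigma,\tau\in\Theta$ with $\sigma\le\tau$ a.s. *)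

theory Defs
  imports "HOL-Probability.Probability"
begin

text \<open>
  Random variables are represented by functions, not by classes modulo almost sure equality;
  accordingly every (in)equality between random variables below is an AE statement.
\<close>

definition Lp :: "'a measure \<Rightarrow> ereal \<Rightarrow> ('a \<Rightarrow> real) set" where
  "Lp M p = {f \<in> borel_measurable M.
     if p = \<infinity> then esssup M (\<lambda>\<omega>. ereal \<bar>f \<omega>\<bar>) < \<infinity>
     else integrable M (\<lambda>\<omega>. \<bar>f \<omega>\<bar> powr real_of_ereal p)}"

text \<open>
  The essential supremum of a (possibly uncountable) family of random variables. It is only
  determined up to null sets, so it is a predicate: \<open>Y\<close> is a version of the essential supremum
  of \<open>(X i)\<close>, \<open>i \<in> I\<close>.
\<close>

definition is_ess_sup :: "'a measure \<Rightarrow> 'i set \<Rightarrow> ('i \<Rightarrow> 'a \<Rightarrow> ereal) \<Rightarrow> ('a \<Rightarrow> ereal) \<Rightarrow> bool" where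
  "is_ess_sup M I X Y \<longleftrightarrow>
     Y \<in> borel_measurable M \<and>
     (\<forall>i\<in>I. AE \<omega> in M. X i \<omega> \<le> Y \<omega>) \<and>
     (\<forall>Z\<in>borel_measurable M. (\<forall>i\<in>I. AE \<omega> in M. X i \<omega> \<le> Z \<omega>) \<longrightarrow> (AE \<omega> in M. Y \<omega> \<le> Z \<omega>))"

text \<open>
  The filtration is indexed by all reals in order to reuse the library's locale, but only its
  restriction to \<open>[0,T]\<close> matters: every filtration on \<open>[0,T]\<close> extends to the real line, and all
  stopping times below take values in \<open>[0,T]\<close>, so that the conditions at times outside \<open>[0,T]\<close>
  in \<^const>\<open>stopping_time\<close> and \<^const>\<open>filtration.pre_sigma\<close> (the sigma-algebra
  \<open>\<F>\<^sub>\<tau>\<close>) follow from those inside.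
\<close>

locale stopping_setting = prob_space M + complete_measure M + filtration "space M" F
  for M :: "'a measure" and F :: "real \<Rightarrow> 'a measure" +
  fixes T :: real and \<theta> :: "nat \<Rightarrow> 'a \<Rightarrow> real" and p :: ereal
  assumes T_pos: "0 < T"
    and F_subalgebra: "\<And>t. t \<in> {0..T} \<Longrightarrow> subalgebra M (F t)"
    and F_right_continuous: "\<And>t. t \<in> {0..<T} \<Longrightarrow> sets (F t) = (\<Inter>s\<in>{t<..T}. sets (F s))"
    and F_complete: "null_sets M \<subseteq> sets (F 0)"
    and \<theta>_stopping_time: "\<And>k. stopping_time F (\<theta> k)"
    and \<theta>_range: "\<And>k \<omega>. \<omega> \<in> space M \<Longrightarrow> \<theta> k \<omega> \<in> {0..T}"
    and \<theta>_zero: "AE \<omega> in M. \<theta> 0 \<omega> = 0"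
    and \<theta>_mono: "\<And>k. AE \<omega> in M. \<theta> k \<omega> \<le> \<theta> (Suc k) \<omega>"
    and \<theta>_lim: "AE \<omega> in M. (\<lambda>k. \<theta> k \<omega>) \<longlonglongrightarrow> T"
    and p_ge_1: "1 \<le> p"
begin

definition Theta :: "('a \<Rightarrow> real) set" where
  "Theta = {\<tau>. stopping_time F \<tau> \<and> (\<forall>\<omega>\<in>space M. \<tau> \<omega> \<in> {0..T}) \<and>
     (\<exists>A B. (\<forall>k. A k \<in> sets (pre_sigma (\<theta> k))) \<and> B \<in> sets (F T) \<and>
        disjoint_family A \<and> (\<forall>k. A k \<inter> B = {}) \<and> (\<Union>k. A k) \<union> B = space M \<and>
        (AE \<omega> in M. \<tau> \<omega> = (\<Sum>k. \<theta> k \<omega> * indicator (A k) \<omega>) + T * indicator B \<omega>))}"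

definition Theta_from :: "('a \<Rightarrow> real) \<Rightarrow> ('a \<Rightarrow> real) set" where
  "Theta_from \<tau> = {\<nu> \<in> Theta. AE \<omega> in M. \<tau> \<omega> \<le> \<nu> \<omega>}"

text \<open>
  The space \<open>L\<^sup>p(\<F>\<^sub>\<tau>)\<close>. Integrability is expressed in \<open>M\<close> because \<^const>\<open>pre_sigma\<close>
  carries the zero measure.
\<close>

definition Lp_at :: "('a \<Rightarrow> real) \<Rightarrow> ('a \<Rightarrow> real) set" where
  "Lp_at \<tau> = borel_measurable (pre_sigma \<tau>) \<inter> Lp M p"

definition admissible_family :: "(('a \<Rightarrow> real) \<Rightarrow> 'a \<Rightarrow> real) \<Rightarrow> bool" where
  "admissible_family \<phi> \<longleftrightarrow>
     (\<forall>\<tau>\<in>Theta. \<phi> \<tau> \<in> borel_measurable (pre_sigma \<tau>)) \<and>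
     (\<forall>\<tau>\<in>Theta. \<forall>\<tau>'\<in>Theta. AE \<omega> in M. \<tau> \<omega> = \<tau>' \<omega> \<longrightarrow> \<phi> \<tau> \<omega> = \<phi> \<tau>' \<omega>)"

definition p_integrable_family :: "(('a \<Rightarrow> real) \<Rightarrow> 'a \<Rightarrow> real) \<Rightarrow> bool" where
  "p_integrable_family \<phi> \<longleftrightarrow> (\<forall>\<tau>\<in>Theta. \<phi> \<tau> \<in> Lp M p)"

definition dominates :: "(('a \<Rightarrow> real) \<Rightarrow> 'a \<Rightarrow> real) \<Rightarrow> (('a \<Rightarrow> real) \<Rightarrow> 'a \<Rightarrow> real) \<Rightarrow> bool" where
  "dominates \<phi> \<phi>' \<longleftrightarrow> (\<forall>\<tau>\<in>Theta. AE \<omega> in M. \<phi> \<tau> \<omega> \<ge> \<phi>' \<tau> \<omega>)"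

text \<open>
  \<open>\<rho> S \<tau> \<eta>\<close> stands for \<open>\<rho>\<^bsub>S,\<tau>\<^esub>[\<eta>]\<close>. The second conjunct says that
  \<open>\<rho> S \<tau>\<close> is well defined on almost sure equivalence classes.
\<close>

definition operator_family ::
  "(('a \<Rightarrow> real) \<Rightarrow> ('a \<Rightarrow> real) \<Rightarrow> ('a \<Rightarrow> real) \<Rightarrow> 'a \<Rightarrow> real) \<Rightarrow> bool" where
  "operator_family \<rho> \<longleftrightarrow>
     (\<forall>S\<in>Theta. \<forall>\<tau>\<in>Theta.
        (\<forall>\<eta>\<in>Lp_at \<tau>. \<rho> S \<tau> \<eta> \<in> Lp_at S) \<and>
        (\<forall>\<eta>\<in>Lp_at \<tau>. \<forall>\<eta>'\<in>Lp_at \<tau>.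
           (AE \<omega> in M. \<eta> \<omega> = \<eta>' \<omega>) \<longrightarrow> (AE \<omega> in M. \<rho> S \<tau> \<eta> \<omega> = \<rho> S \<tau> \<eta>' \<omega>)))"

definition op_admissible ::
  "(('a \<Rightarrow> real) \<Rightarrow> ('a \<Rightarrow> real) \<Rightarrow> ('a \<Rightarrow> real) \<Rightarrow> 'a \<Rightarrow> real) \<Rightarrow> bool" where
  "op_admissible \<rho> \<longleftrightarrow>
     (\<forall>S\<in>Theta. \<forall>S'\<in>Theta. \<forall>\<tau>\<in>Theta. \<forall>\<eta>\<in>Lp_at \<tau>.
        AE \<omega> in M. S \<omega> = S' \<omega> \<longrightarrow> \<rho> S \<tau> \<eta> \<omega> = \<rho> S' \<tau> \<eta> \<omega>)"

definition knowledge_preserving ::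
  "(('a \<Rightarrow> real) \<Rightarrow> ('a \<Rightarrow> real) \<Rightarrow> ('a \<Rightarrow> real) \<Rightarrow> 'a \<Rightarrow> real) \<Rightarrow> bool" where
  "knowledge_preserving \<rho> \<longleftrightarrow>
     (\<forall>S\<in>Theta. \<forall>\<tau>\<in>Theta_from S. \<forall>\<eta>\<in>Lp_at S. AE \<omega> in M. \<rho> \<tau> S \<eta> \<omega> = \<eta> \<omega>)"

definition op_monotone ::
  "(('a \<Rightarrow> real) \<Rightarrow> ('a \<Rightarrow> real) \<Rightarrow> ('a \<Rightarrow> real) \<Rightarrow> 'a \<Rightarrow> real) \<Rightarrow> bool" where
  "op_monotone \<rho> \<longleftrightarrow>
     (\<forall>S\<in>Theta. \<forall>\<tau>\<in>Theta. \<forall>\<eta>1\<in>Lp_at \<tau>. \<forall>\<eta>2\<in>Lp_at \<tau>.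
        (AE \<omega> in M. \<eta>1 \<omega> \<le> \<eta>2 \<omega>) \<longrightarrow> (AE \<omega> in M. \<rho> S \<tau> \<eta>1 \<omega> \<le> \<rho> S \<tau> \<eta>2 \<omega>))"

definition op_consistent ::
  "(('a \<Rightarrow> real) \<Rightarrow> ('a \<Rightarrow> real) \<Rightarrow> ('a \<Rightarrow> real) \<Rightarrow> 'a \<Rightarrow> real) \<Rightarrow> bool" where
  "op_consistent \<rho> \<longleftrightarrow>
     (\<forall>S\<in>Theta. \<forall>\<kappa>\<in>Theta. \<forall>\<tau>\<in>Theta. \<forall>\<eta>\<in>Lp_at \<tau>.
        (AE \<omega> in M. S \<omega> \<le> \<kappa> \<omega>) \<and> (AE \<omega> in M. \<kappa> \<omega> \<le> \<tau> \<omega>) \<longrightarrow>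
        (AE \<omega> in M. \<rho> S \<kappa> (\<rho> \<kappa> \<tau> \<eta>) \<omega> = \<rho> S \<tau> \<eta> \<omega>))"

definition zero_one_law ::
  "(('a \<Rightarrow> real) \<Rightarrow> ('a \<Rightarrow> real) \<Rightarrow> ('a \<Rightarrow> real) \<Rightarrow> 'a \<Rightarrow> real) \<Rightarrow> bool" where
  "zero_one_law \<rho> \<longleftrightarrow>
     (\<forall>\<zeta>. admissible_family \<zeta> \<and> p_integrable_family \<zeta> \<longrightarrow>
       (\<forall>S\<in>Theta. \<forall>A\<in>sets (pre_sigma S). \<forall>\<tau>\<in>Theta_from S. \<forall>\<tau>'\<in>Theta_from S.
          (AE \<omega> in M. \<omega> \<in> A \<longrightarrow> \<tau> \<omega> = \<tau>' \<omega>) \<longrightarrow>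
          (AE \<omega> in M. indicator A \<omega> * \<rho> S \<tau> (\<zeta> \<tau>) \<omega> = indicator A \<omega> * \<rho> S \<tau>' (\<zeta> \<tau>') \<omega>)))"

text \<open>
  The real supremum over \<open>n\<close> is the genuine one almost surely, because the sequence
  converges almost surely to the finite limit \<open>\<eta>\<close>. The limes inferior is taken in the
  extended reals, as it may be infinite.
\<close>

definition monotone_Fatou ::
  "(('a \<Rightarrow> real) \<Rightarrow> ('a \<Rightarrow> real) \<Rightarrow> ('a \<Rightarrow> real) \<Rightarrow> 'a \<Rightarrow> real) \<Rightarrow> bool" where
  "monotone_Fatou \<rho> \<longleftrightarrow>
     (\<forall>S\<in>Theta. \<forall>\<tau>\<in>Theta. \<forall>\<eta>\<in>Lp_at \<tau>. \<forall>\<eta>n :: nat \<Rightarrow> 'a \<Rightarrow> real.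
        (\<forall>n. \<eta>n n \<in> Lp_at \<tau>) \<and>
        (\<forall>n. AE \<omega> in M. \<eta>n n \<omega> \<le> \<eta>n (Suc n) \<omega>) \<and>
        (\<lambda>\<omega>. SUP n. \<eta>n n \<omega>) \<in> Lp M p \<and>
        (AE \<omega> in M. (\<lambda>n. \<eta>n n \<omega>) \<longlonglongrightarrow> \<eta> \<omega>) \<longrightarrow>
        (AE \<omega> in M. ereal (\<rho> S \<tau> \<eta> \<omega>) \<le> liminf (\<lambda>n. ereal (\<rho> S \<tau> (\<eta>n n) \<omega>))))"

definition supermartingale_family ::
  "(('a \<Rightarrow> real) \<Rightarrow> ('a \<Rightarrow> real) \<Rightarrow> ('a \<Rightarrow> real) \<Rightarrow> 'a \<Rightarrow> real) \<Rightarrow>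
   (('a \<Rightarrow> real) \<Rightarrow> 'a \<Rightarrow> real) \<Rightarrow> bool" where
  "supermartingale_family \<rho> \<phi> \<longleftrightarrow>
     admissible_family \<phi> \<and> p_integrable_family \<phi> \<and>
     (\<forall>\<sigma>\<in>Theta. \<forall>\<tau>\<in>Theta. (AE \<omega> in M. \<sigma> \<omega> \<le> \<tau> \<omega>) \<longrightarrow>
        (AE \<omega> in M. \<rho> \<sigma> \<tau> (\<phi> \<tau>) \<omega> \<le> \<phi> \<sigma> \<omega>))"

text \<open>
  \<open>V\<close> is a (real-valued) version of the value family of \<open>\<xi>\<close>; neither
  \<open>\<F>\<^sub>\<nu>\<close>-measurability of \<open>V \<nu>\<close> nor admissibility of \<open>V\<close> is part of the definition.
\<close>

definition is_value_family ::
  "(('a \<Rightarrow> real) \<Rightarrow> ('a \<Rightarrow> real) \<Rightarrow> ('a \<Rightarrow> real) \<Rightarrow> 'a \<Rightarrow> real) \<Rightarrow>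
   (('a \<Rightarrow> real) \<Rightarrow> 'a \<Rightarrow> real) \<Rightarrow> (('a \<Rightarrow> real) \<Rightarrow> 'a \<Rightarrow> real) \<Rightarrow> bool" where
  "is_value_family \<rho> \<xi> V \<longleftrightarrow>
     (\<forall>\<nu>\<in>Theta. is_ess_sup M (Theta_from \<nu>) (\<lambda>\<tau> \<omega>. ereal (\<rho> \<nu> \<tau> (\<xi> \<tau>) \<omega>)) (\<lambda>\<omega>. ereal (V \<nu> \<omega>)))"

definition is_Snell_envelope ::
  "(('a \<Rightarrow> real) \<Rightarrow> ('a \<Rightarrow> real) \<Rightarrow> ('a \<Rightarrow> real) \<Rightarrow> 'a \<Rightarrow> real) \<Rightarrow>
   (('a \<Rightarrow> real) \<Rightarrow> 'a \<Rightarrow> real) \<Rightarrow> (('a \<Rightarrow> real) \<Rightarrow> 'a \<Rightarrow> real) \<Rightarrow> bool" where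
  "is_Snell_envelope \<rho> \<xi> V \<longleftrightarrow>
     supermartingale_family \<rho> V \<and> dominates V \<xi> \<and>
     (\<forall>\<phi>. supermartingale_family \<rho> \<phi> \<and> dominates \<phi> \<xi> \<longrightarrow> dominates \<phi> V)"

end

end

theory Submission
  imports Defs
begin

text \<open>
  By the zero-one law, the random variables \<open>\<rho>\<^bsub>\<nu>,\<tau>\<^esub>[\<xi>(\<tau>)]\<close>, \<open>\<tau> \<in> \<Theta>\<^sub>\<nu>\<close>, form an upward directed
  family: the maximum of two of them is attained by pasting the two stopping times along the event
  in \<open>\<F>\<^sub>\<nu>\<close> on which the first one wins. Hence \<open>V(\<nu>)\<close> is the limit of a non-decreasing sequence
  \<open>\<rho>\<^bsub>\<nu>,\<kappa>\<^sub>n\<^esub>[\<xi>(\<kappa>\<^sub>n)]\<close>, which the monotone Fatou property and consistency push through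
  \<open>\<rho>\<^bsub>\<sigma>,\<nu>\<^esub>\<close>. Minimality is monotonicity applied to \<open>\<xi> \<le> \<phi>\<close>.
\<close>

section \<open>Almost sure modifications\<close>

text \<open>\<open>A\<close> and \<open>B\<close> differ only inside a null set \<open>E\<close>,
  and \<open>B = (A - E) \<union> (E \<inter> B)\<close>. By completeness
  \<open>E \<inter> B\<close> is again a null set, and \<open>N\<close> contains every null set.
  This keeps events that are fixed only almost surely inside the sigma-algebra of a stopping
  time.\<close>

lemma (in complete_measure) sets_cong_AE_subalgebra:
  assumes "space N = space M" "null_sets M \<subseteq> sets N"
    and A: "A \<in> sets N" and B: "B \<subseteq> space M" and eq: "AE x in M. x \<in> A \<longleftrightarrow> x \<in> B"
  shows "B \<in> sets N"
proof -
  obtain E where E: "{x \<in> space M. \<not> (x \<in> A \<longleftrightarrow> x \<in> B)} \<subseteq> E"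
    and "emeasure M E = 0" "E \<in> sets M"
    by (rule AE_E[OF eq]) (rule that)
  then have null: "E \<in> null_sets M"
    by (simp add: null_setsI)
  have "E \<inter> B \<in> sets M"
    using complete[of "E \<inter> B" E] null by auto
  then have "E \<inter> B \<in> null_sets M"
    by (rule null_sets_subset[OF null]) auto
  moreover have "B = (A - E) \<union> (E \<inter> B)"
    using E B sets.sets_into_space[OF A] unfolding assms(1) by blast
  moreover have "A - E \<in> sets N"
    using A null assms(2) by blast
  ultimately show ?thesis
    using assms(2) by (metis sets.Un subsetD)
qed

text \<open>The preimages of a set under \<open>f\<close> and \<open>g\<close> agree almost surely,
  so the version for sets applies to each of them.\<close>

lemma (in complete_measure) measurable_cong_AE_subalgebra:
  assumes N: "space N = space M" "null_sets M \<subseteq> sets N"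
    and f: "f \<in> measurable N L" and eq: "AE x in M. f x = g x"
    and g: "g \<in> space M \<rightarrow> space L"
  shows "g \<in> measurable N L"
proof (rule measurableI)
  show "g x \<in> space L" if "x \<in> space N" for x
    using that g N by auto
  show "g -` A \<inter> space N \<in> sets N" if "A \<in> sets L" for A
  proof (rule sets_cong_AE_subalgebra[OF N])
    show "f -` A \<inter> space N \<in> sets N"
      using f that by (rule measurable_sets)
    show "AE x in M. x \<in> f -` A \<inter> space N \<longleftrightarrow> x \<in> g -` A \<inter> space N"
      using eq by eventually_elim auto
    show "g -` A \<inter> space N \<subseteq> space M"
      using N(1) by simp
  qed
qed

lemma Lp_cong_AE:
  assumes f: "f \<in> Lp M p" and g: "g \<in> borel_measurable M" and eq: "AE x in M. f x = g x"
  shows "g \<in> Lp M p"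
proof -
  have f': "f \<in> borel_measurable M"
    using f by (auto simp: Lp_def)
  have "esssup M (\<lambda>x. ereal \<bar>f x\<bar>) = esssup M (\<lambda>x. ereal \<bar>g x\<bar>)"
  proof (rule esssup_AE_cong)
    show "AE x in M. ereal \<bar>f x\<bar> = ereal \<bar>g x\<bar>"
      using eq by eventually_elim simp
  qed (use f' g in measurable)
  moreover have "integrable M (\<lambda>x. \<bar>f x\<bar> powr real_of_ereal p) =
      integrable M (\<lambda>x. \<bar>g x\<bar> powr real_of_ereal p)"
  proof (rule integrable_cong_AE)
    show "AE x in M. \<bar>f x\<bar> powr real_of_ereal p = \<bar>g x\<bar> powr real_of_ereal p"
      using eq by eventually_elim simp
  qed (use f' g in measurable)
  ultimately show ?thesis
    using f g by (auto simp: Lp_def)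
qed

text \<open>Only the term with index \<open>k\<close> can be nonzero at \<open>x\<close>. This
  evaluates the series in the definition of \<open>Theta\<close> on a piece of the
  partition.\<close>

lemma suminf_mult_indicator_disjoint:
  fixes f :: "nat \<Rightarrow> real"
  assumes "disjoint_family A" "x \<in> A k"
  shows "(\<Sum>i. f i * indicator (A i) x) = f k"
proof -
  have "(\<lambda>i. f i * indicator (A i) x) = (\<lambda>i. if i = k then f i else 0)"
    using assms by (auto simp: disjoint_family_on_def indicator_def fun_eq_iff)
  then show ?thesis
    using sums_unique[OF sums_single[of k f]] by simp
qed

section \<open>Essential suprema of directed families\<close>

text \<open>Composing with \<open>arctan\<close> makes the expectations finite, so that they can be maximised.\<close>

lemma (in prob_space) directed_ess_sup_sequence:
  fixes X :: "'i \<Rightarrow> 'a \<Rightarrow> real" and Y :: "'a \<Rightarrow> real"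
  assumes ne: "I \<noteq> {}" and X: "\<And>i. i \<in> I \<Longrightarrow> X i \<in> borel_measurable M"
    and directed: "\<And>i j. i \<in> I \<Longrightarrow> j \<in> I \<Longrightarrow> \<exists>k\<in>I. AE x in M. max (X i x) (X j x) \<le> X k x"
    and sup: "is_ess_sup M I (\<lambda>i x. ereal (X i x)) (\<lambda>x. ereal (Y x))"
  obtains s :: "nat \<Rightarrow> 'i" where "\<And>n. s n \<in> I"
    and "\<And>n. AE x in M. X (s n) x \<le> X (s (Suc n)) x"
    and "AE x in M. (\<lambda>n. X (s n) x) \<longlonglongrightarrow> Y x"
proof -
  define e where "e i = expectation (\<lambda>x. arctan (X i x))" for i
  define c where "c = Sup (e ` I)"
  have arctan_measurable: "(\<lambda>x. arctan (f x)) \<in> borel_measurable M"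
    if "f \<in> borel_measurable M" for f
    by (rule borel_measurable_continuous_on[OF _ that]) (auto intro!: continuous_intros)
  have abs_arctan: "\<bar>arctan t\<bar> \<le> pi / 2" for t
    using arctan_bounded[of t] by auto
  have int: "integrable M (\<lambda>x. arctan (f x))" if "f \<in> borel_measurable M" for f
    using arctan_measurable[OF that] abs_arctan by (intro integrable_const_bound[of _ "pi / 2"]) auto
  have e_mono: "e i \<le> e j" if "i \<in> I" "j \<in> I" "AE x in M. X i x \<le> X j x" for i j
    unfolding e_def using that by (intro integral_mono_AE int X) (auto simp: arctan_monotone')
  have "e i \<le> pi / 2" if "i \<in> I" for i
    unfolding e_def using arctan_ubound
    by (intro integral_le_const int X that) (auto intro: less_imp_le)
  then have bdd: "bdd_above (e ` I)"
    by (rule bdd_aboveI2)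
  then have e_le: "e i \<le> c" if "i \<in> I" for i
    unfolding c_def using that by (intro cSup_upper) auto
  have approx: "\<exists>i\<in>I. c - 1 / Suc n < e i" for n
  proof -
    have "c - 1 / Suc n < Sup (e ` I)"
      unfolding c_def[symmetric] by simp
    then show ?thesis
      using less_cSup_iff[of "e ` I"] bdd ne by auto
  qed
  \<comment> \<open>Dependent choice maintains near-optimality and monotonicity together: the next
    index is a common upper bound of the current one and of an index that is optimal up to the next
    tolerance.\<close>
  have "\<exists>s. \<forall>n. (s n \<in> I \<and> c - 1 / Suc n < e (s n)) \<and>
      (AE x in M. X (s n) x \<le> X (s (Suc n)) x)"
  proof (rule dependent_nat_choice)
    show "\<exists>i. i \<in> I \<and> c - 1 / Suc 0 < e i"
      using approx[of 0] by auto
    fix i n assume i: "i \<in> I \<and> c - 1 / Suc n < e i"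
    obtain j where j: "j \<in> I" "c - 1 / Suc (Suc n) < e j"
      using approx by blast
    obtain k where k: "k \<in> I" "AE x in M. max (X i x) (X j x) \<le> X k x"
      using directed i j(1) by blast
    then have "e j \<le> e k"
      using j(1) by (intro e_mono) auto
    moreover have "AE x in M. X i x \<le> X k x"
      using k(2) by auto
    ultimately show "\<exists>k. (k \<in> I \<and> c - 1 / Suc (Suc n) < e k) \<and> (AE x in M. X i x \<le> X k x)"
      using k(1) j(2) by force
  qed
  then obtain s where s: "\<And>n. s n \<in> I" "\<And>n. c - 1 / Suc n < e (s n)"
    and mono: "\<And>n. AE x in M. X (s n) x \<le> X (s (Suc n)) x"
    by metis
  \<comment> \<open>\<open>lim\<close> is total, which gives measurability everywhere. The limit
    exists almost surely because the sequence is non-decreasing and bounded by the finite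
    \<open>Y\<close>.\<close>
  define S where "S x = lim (\<lambda>n. X (s n) x)" for x
  have S: "S \<in> borel_measurable M"
    unfolding S_def using X s(1) by (intro borel_measurable_lim_metric) auto
  have "AE x in M. \<forall>n. X (s n) x \<le> Y x"
    using sup s(1) by (subst AE_all_countable) (auto simp: is_ess_sup_def)
  moreover have "AE x in M. \<forall>n. X (s n) x \<le> X (s (Suc n)) x"
    using mono by (subst AE_all_countable) auto
  ultimately have lims: "AE x in M. (\<lambda>n. X (s n) x) \<longlonglongrightarrow> S x \<and> (\<forall>n. X (s n) x \<le> S x) \<and> S x \<le> Y x"
  proof eventually_elim
    case (elim x)
    then have inc: "incseq (\<lambda>n. X (s n) x)"
      by (intro incseq_SucI) auto
    then obtain L where L: "(\<lambda>n. X (s n) x) \<longlonglongrightarrow> L" "\<forall>n. X (s n) x \<le> L"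
      using incseq_convergent[of "\<lambda>n. X (s n) x" "Y x"] elim by auto
    then have "S x = L"
      unfolding S_def by (intro limI)
    moreover have "L \<le> Y x"
      using L(1) elim by (intro LIMSEQ_le_const2) auto
    ultimately show ?case
      using L by auto
  qed
  have "AE x in M. X i x \<le> S x" if i: "i \<in> I" for i
  proof -
    \<comment> \<open>The positive part is nonnegative, so it vanishes almost surely once its
      expectation is shown to be at most 0; strict monotonicity of \<open>arctan\<close> then gives
      \<open>X i x \<le> S x\<close>.\<close>
    define g where "g x = max (arctan (X i x) - arctan (S x)) 0" for x
    have g: "integrable M g"
      unfolding g_def by (intro integrable_max Bochner_Integration.integrable_diff int X i S) auto
    have "expectation g \<le> 1 / Suc n" for n
    proof -
      \<comment> \<open>With \<open>k\<close> above both \<open>i\<close> and \<open>s n\<close>,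
        the difference \<open>arctan (X k x) - arctan (X (s n) x)\<close> bounds both terms of the
        maximum, since \<open>X (s n) x \<le> S x\<close>. Its expectation is at most
        \<open>c - (c - 1 / Suc n)\<close>.\<close>
      obtain k where k: "k \<in> I" "AE x in M. max (X i x) (X (s n) x) \<le> X k x"
        using directed i s(1) by blast
      have "expectation g \<le> expectation (\<lambda>x. arctan (X k x) - arctan (X (s n) x))"
      proof (rule integral_mono_AE)
        show "AE x in M. g x \<le> arctan (X k x) - arctan (X (s n) x)"
          using lims k(2)
        proof eventually_elim
          case (elim x)
          then have "arctan (X i x) \<le> arctan (X k x)" "arctan (X (s n) x) \<le> arctan (X k x)"
            "arctan (X (s n) x) \<le> arctan (S x)"
            by (auto intro!: arctan_monotone')
          then show ?case
            by (auto simp: g_def)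
        qed
      qed (intro g Bochner_Integration.integrable_diff int X k s)+
      also have "\<dots> = e k - e (s n)"
        unfolding e_def by (intro Bochner_Integration.integral_diff int X k s)
      also have "\<dots> \<le> 1 / Suc n"
        using e_le[OF k(1)] s(2)[of n] by simp
      finally show ?thesis .
    qed
    then have "expectation g \<le> 0"
      by (intro LIMSEQ_le_const[OF LIMSEQ_inverse_real_of_nat]) (auto simp: inverse_eq_divide)
    moreover have "expectation g \<ge> 0"
      by (intro integral_nonneg_AE) (auto simp: g_def)
    ultimately have "AE x in M. g x = 0"
      using g by (subst integral_nonneg_eq_0_iff_AE[symmetric]) (auto simp: g_def)
    then show ?thesis
    proof eventually_elim
      case (elim x)
      then have "arctan (X i x) \<le> arctan (S x)"
        by (auto simp: g_def max_def split: if_splits)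
      then show ?case
        by (simp add: arctan_le_iff)
    qed
  qed
  \<comment> \<open>\<open>S\<close> is now a measurable upper bound, hence above the essential
    supremum; the reverse inequality is part of \<open>lims\<close>.\<close>
  then have "AE x in M. ereal (Y x) \<le> ereal (S x)"
    using sup S unfolding is_ess_sup_def by (elim conjE ballE[of _ _ "\<lambda>x. ereal (S x)"]) auto
  then have "AE x in M. (\<lambda>n. X (s n) x) \<longlonglongrightarrow> Y x"
    using lims by eventually_elim (metis antisym ereal_less_eq(3))
  then show thesis
    using that s(1) mono by blast
qed

section \<open>Sigma-algebras of bounded stopping times\<close>

context stopping_setting
begin

text \<open>The common features of the \<open>\<theta> k\<close> and of the elements of
  \<open>Theta\<close>, so that the facts on \<open>pre_sigma\<close> are proved once for
  both.\<close>

definition bounded_stopping_time :: "('a \<Rightarrow> real) \<Rightarrow> bool" where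
  "bounded_stopping_time \<tau> \<longleftrightarrow> stopping_time F \<tau> \<and> (\<forall>\<omega>\<in>space M. \<tau> \<omega> \<in> {0..T})"

lemma sets_F_subset: "sets (F T) \<subseteq> sets M"
  using F_subalgebra[of T] T_pos by (auto simp: subalgebra_def)

text \<open>As \<open>\<tau> \<le> T\<close>, an event \<open>A\<close> coincides with its part on
  \<open>\<tau> \<le> T\<close>, which lies in \<open>F T\<close>.\<close>

lemma sets_pre_sigma_subset:
  assumes "bounded_stopping_time \<tau>"
  shows "sets (pre_sigma \<tau>) \<subseteq> sets M"
proof
  fix A assume A: "A \<in> sets (pre_sigma \<tau>)"
  then have "{\<omega> \<in> A. \<tau> \<omega> \<le> T} = A"
    using sets.sets_into_space[OF A] assms
    by (auto simp: bounded_stopping_time_def space_pre_sigma)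
  then show "A \<in> sets M"
    using sets_pre_sigmaD[OF _ A, of T] assms sets_F_subset
    by (auto simp: bounded_stopping_time_def)
qed

text \<open>Completeness places null sets in \<open>F 0\<close>, hence in \<open>F t\<close> for
  \<open>t \<ge> 0\<close>. At negative times the event to be tested is empty because
  \<open>\<tau> \<ge> 0\<close>.\<close>

lemma null_sets_subset_pre_sigma:
  assumes "bounded_stopping_time \<tau>"
  shows "null_sets M \<subseteq> sets (pre_sigma \<tau>)"
proof
  fix N assume N: "N \<in> null_sets M"
  have sub: "N \<subseteq> space M"
    using N sets.sets_into_space by auto
  show "N \<in> sets (pre_sigma \<tau>)"
  proof (rule sets_pre_sigmaI)
    show "stopping_time F \<tau>"
      using assms by (simp add: bounded_stopping_time_def)
    show "{\<omega> \<in> N. \<tau> \<omega> \<le> t} \<in> sets (F t)" for t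
    proof (cases "t < 0")
      case True
      then have "{\<omega> \<in> N. \<tau> \<omega> \<le> t} = {}"
        using sub assms by (force simp: bounded_stopping_time_def)
      then show ?thesis
        by (simp only: sets.empty_sets)
    next
      case False
      have "{\<omega> \<in> N. \<tau> \<omega> \<le> t} \<in> sets M"
        using complete[OF _ N] by auto
      then have "{\<omega> \<in> N. \<tau> \<omega> \<le> t} \<in> null_sets M"
        by (rule null_sets_subset[OF N]) auto
      then show ?thesis
        using F_complete sets_F_mono[of 0 t] False by auto
    qed
  qed
qed

lemma sets_pre_sigma_cong_AE:
  assumes "bounded_stopping_time \<tau>" "A \<in> sets (pre_sigma \<tau>)" "B \<subseteq> space M"
    and "AE \<omega> in M. \<omega> \<in> A \<longleftrightarrow> \<omega> \<in> B"
  shows "B \<in> sets (pre_sigma \<tau>)"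
  by (rule sets_cong_AE_subalgebra[OF space_pre_sigma null_sets_subset_pre_sigma[OF assms(1)] assms(2-4)])

text \<open>When \<open>R \<omega> \<le> t\<close>, the condition
  \<open>S \<omega> \<le> R \<omega>\<close> amounts to \<open>S \<omega> \<le> t\<close> together
  with the same comparison of the times truncated at \<open>t\<close>, and all of these are visible
  in \<open>F t\<close>.\<close>

lemma pre_sigma_Int_le:
  assumes S: "stopping_time F S" and R: "stopping_time F R" and A: "A \<in> sets (pre_sigma S)"
  shows "A \<inter> {\<omega> \<in> space M. S \<omega> \<le> R \<omega>} \<in> sets (pre_sigma R)"
proof (rule sets_pre_sigmaI[OF R])
  fix t
  \<comment> \<open>Truncation makes the time observable at \<open>t\<close>: the event that it is
    at most \<open>u\<close> is the whole space if \<open>t \<le> u\<close>, and otherwise it lies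
    in \<open>F t\<close> because \<open>u < t\<close>.\<close>
  have min_measurable: "(\<lambda>\<omega>. min (Q \<omega>) t) \<in> borel_measurable (F t)" if "stopping_time F Q" for Q
  proof (rule borel_measurableI_le)
    fix u
    have "Measurable.pred (F t) (\<lambda>\<omega>. min (Q \<omega>) t \<le> u)"
    proof (cases "t \<le> u")
      case False
      then show ?thesis
        using stopping_time_le_const[OF that, of u t] by (simp add: min_le_iff_disj)
    qed (simp add: min_le_iff_disj)
    then show "{\<omega> \<in> space (F t). min (Q \<omega>) t \<le> u} \<in> sets (F t)"
      by (simp add: pred_def)
  qed
  have "{\<omega> \<in> space (F t). min (S \<omega>) t \<le> min (R \<omega>) t} \<in> sets (F t)"
    using min_measurable[OF S] min_measurable[OF R] by measurable
  moreover have "{\<omega> \<in> A. S \<omega> \<le> t} \<in> sets (F t)"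
    using S A by (rule sets_pre_sigmaD)
  moreover have "{\<omega> \<in> space (F t). R \<omega> \<le> t} \<in> sets (F t)"
    using stopping_timeD[OF R] by (simp add: pred_def)
  ultimately have "{\<omega> \<in> A. S \<omega> \<le> t} \<inter> {\<omega> \<in> space (F t). R \<omega> \<le> t} \<inter>
      {\<omega> \<in> space (F t). min (S \<omega>) t \<le> min (R \<omega>) t} \<in> sets (F t)"
    by blast
  moreover have "{\<omega> \<in> A \<inter> {\<omega> \<in> space M. S \<omega> \<le> R \<omega>}. R \<omega> \<le> t} =
      {\<omega> \<in> A. S \<omega> \<le> t} \<inter> {\<omega> \<in> space (F t). R \<omega> \<le> t} \<inter>
      {\<omega> \<in> space (F t). min (S \<omega>) t \<le> min (R \<omega>) t}"
    by (auto simp: space_F)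
  ultimately show "{\<omega> \<in> A \<inter> {\<omega> \<in> space M. S \<omega> \<le> R \<omega>}. R \<omega> \<le> t} \<in> sets (F t)"
    by (simp only:)
qed

text \<open>Intersecting \<open>A\<close> with the almost sure event that \<open>S\<close> is at
  most \<open>R\<close> changes it by a null set only, and the intersection is an event of
  \<open>R\<close>.\<close>

lemma sets_pre_sigma_mono_AE:
  assumes S: "bounded_stopping_time S" and R: "bounded_stopping_time R"
    and le: "AE \<omega> in M. S \<omega> \<le> R \<omega>" and A: "A \<in> sets (pre_sigma S)"
  shows "A \<in> sets (pre_sigma R)"
proof (rule sets_pre_sigma_cong_AE[OF R])
  show "A \<inter> {\<omega> \<in> space M. S \<omega> \<le> R \<omega>} \<in> sets (pre_sigma R)"
    using S R A by (intro pre_sigma_Int_le) (auto simp: bounded_stopping_time_def)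
  show "A \<subseteq> space M"
    using sets.sets_into_space[OF A] by (simp add: space_pre_sigma)
  show "AE \<omega> in M. \<omega> \<in> A \<inter> {\<omega> \<in> space M. S \<omega> \<le> R \<omega>} \<longleftrightarrow> \<omega> \<in> A"
    using le AE_space by eventually_elim auto
qed

text \<open>The complement consists of the two strict orders. The event \<open>R < S\<close> is
  first obtained for \<open>R\<close> and then transferred to \<open>S\<close> by intersecting it
  with \<open>R \<le> S\<close>, which contains it.\<close>

lemma eq_set_pre_sigma:
  assumes S: "stopping_time F S" and R: "stopping_time F R"
  shows "{\<omega> \<in> space M. S \<omega> = R \<omega>} \<in> sets (pre_sigma S)"
proof -
  have RS: "{\<omega> \<in> space M. S \<omega> < R \<omega>} \<in> sets (pre_sigma S)"
    using stopping_time_less[OF S R] unfolding pred_def space_pre_sigma .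
  have "{\<omega> \<in> space M. R \<omega> < S \<omega>} \<in> sets (pre_sigma R)"
    using stopping_time_less[OF R S] unfolding pred_def space_pre_sigma .
  then have "{\<omega> \<in> space M. R \<omega> < S \<omega>} \<inter> {\<omega> \<in> space M. R \<omega> \<le> S \<omega>} \<in> sets (pre_sigma S)"
    by (rule pre_sigma_Int_le[OF R S])
  with RS have "space (pre_sigma S) - {\<omega> \<in> space M. S \<omega> < R \<omega>} -
      ({\<omega> \<in> space M. R \<omega> < S \<omega>} \<inter> {\<omega> \<in> space M. R \<omega> \<le> S \<omega>}) \<in> sets (pre_sigma S)"
    by (intro sets.Diff sets.top)
  moreover have "{\<omega> \<in> space M. S \<omega> = R \<omega>} =
      space (pre_sigma S) - {\<omega> \<in> space M. S \<omega> < R \<omega>} -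
      ({\<omega> \<in> space M. R \<omega> < S \<omega>} \<inter> {\<omega> \<in> space M. R \<omega> \<le> S \<omega>})"
    unfolding space_pre_sigma by (auto simp: not_less)
  ultimately show ?thesis
    by (simp only:)
qed

section \<open>The set \<open>Theta\<close> and pasting of its elements\<close>

lemma bounded_stopping_time_Theta: "\<tau> \<in> Theta \<Longrightarrow> bounded_stopping_time \<tau>"
  by (simp add: Theta_def bounded_stopping_time_def)

lemma stopping_time_Theta: "\<tau> \<in> Theta \<Longrightarrow> stopping_time F \<tau>"
  by (simp add: Theta_def)

lemma bounded_stopping_time_\<theta>: "bounded_stopping_time (\<theta> k)"
  using \<theta>_stopping_time \<theta>_range by (auto simp: bounded_stopping_time_def)

lemma const_in_Theta: "(\<lambda>_. T) \<in> Theta"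
proof -
  have "space M \<in> sets (F T)"
    using sets.top[of "F T"] by (simp add: space_F)
  then show ?thesis
    using T_pos unfolding Theta_def
    by (intro CollectI conjI exI[of _ "\<lambda>_. {}"] exI[of _ "space M"])
      (simp_all add: stopping_time_const disjoint_family_on_def)
qed

text \<open>The partition of \<open>\<tau>\<close> cut down to \<open>E\<close> and that of
  \<open>\<tau>'\<close> cut down to the complement form a partition for the pasted time. The point
  is that each cut piece still belongs to the sigma-algebra of its
  \<open>\<theta> k\<close>.\<close>

lemma paste_in_Theta:
  assumes \<tau>: "\<tau> \<in> Theta" and \<tau>': "\<tau>' \<in> Theta"
    and E: "E \<in> sets (pre_sigma \<tau>)" and E': "E \<in> sets (pre_sigma \<tau>')"
  shows "(\<lambda>\<omega>. if \<omega> \<in> E then \<tau> \<omega> else \<tau>' \<omega>) \<in> Theta"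
proof -
  \<comment> \<open>On \<open>A k\<close> the time \<open>\<sigma>\<close> equals
    \<open>\<theta> k\<close> almost surely. Restricting \<open>G\<close> to
    \<open>\<sigma> \<le> \<theta> k\<close> therefore costs only a null set, and turns an event of
    \<open>\<sigma>\<close> into one of \<open>\<theta> k\<close>.\<close>
  have Int: "A k \<inter> G \<in> sets (pre_sigma (\<theta> k))"
    if \<sigma>: "\<sigma> \<in> Theta" and A: "\<And>k. A k \<in> sets (pre_sigma (\<theta> k))" and dj: "disjoint_family A"
      and AB: "\<And>k. A k \<inter> B = {}"
      and eq: "AE \<omega> in M. \<sigma> \<omega> = (\<Sum>k. \<theta> k \<omega> * indicator (A k) \<omega>) + T * indicator B \<omega>"
      and G: "G \<in> sets (pre_sigma \<sigma>)" for \<sigma> A B G k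
  proof (rule sets_pre_sigma_cong_AE[OF bounded_stopping_time_\<theta>])
    show "A k \<inter> (G \<inter> {\<omega> \<in> space M. \<sigma> \<omega> \<le> \<theta> k \<omega>}) \<in> sets (pre_sigma (\<theta> k))"
      using A G \<sigma> \<theta>_stopping_time by (intro sets.Int pre_sigma_Int_le) (auto simp: stopping_time_Theta)
    show "A k \<inter> G \<subseteq> space M"
      using sets.sets_into_space[OF G] by (auto simp: space_pre_sigma)
    show "AE \<omega> in M. \<omega> \<in> A k \<inter> (G \<inter> {\<omega> \<in> space M. \<sigma> \<omega> \<le> \<theta> k \<omega>}) \<longleftrightarrow> \<omega> \<in> A k \<inter> G"
      using eq AE_space
    proof eventually_elim
      case (elim \<omega>)
      have "\<sigma> \<omega> = \<theta> k \<omega>" if "\<omega> \<in> A k"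
        using elim(1) that suminf_mult_indicator_disjoint[OF dj that, of "\<lambda>k. \<theta> k \<omega>"] AB[of k]
        by (auto simp: indicator_def)
      then show ?case
        using elim(2) by auto
    qed
  qed
  obtain A B where A: "\<forall>k. A k \<in> sets (pre_sigma (\<theta> k))" "B \<in> sets (F T)" "disjoint_family A"
    "\<forall>k. A k \<inter> B = {}" "(\<Union>k. A k) \<union> B = space M"
    "AE \<omega> in M. \<tau> \<omega> = (\<Sum>k. \<theta> k \<omega> * indicator (A k) \<omega>) + T * indicator B \<omega>"
    using \<tau> unfolding Theta_def by (elim CollectE conjE exE) (rule that)
  obtain A' B' where A': "\<forall>k. A' k \<in> sets (pre_sigma (\<theta> k))" "B' \<in> sets (F T)" "disjoint_family A'"
    "\<forall>k. A' k \<inter> B' = {}" "(\<Union>k. A' k) \<union> B' = space M"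
    "AE \<omega> in M. \<tau>' \<omega> = (\<Sum>k. \<theta> k \<omega> * indicator (A' k) \<omega>) + T * indicator B' \<omega>"
    using \<tau>' unfolding Theta_def by (elim CollectE conjE exE) (rule that)
  have sub: "E \<subseteq> space M"
    using sets.sets_into_space[OF E] by (simp add: space_pre_sigma)
  have cE': "space M - E \<in> sets (pre_sigma \<tau>')"
    using sets.compl_sets[OF E'] by (simp add: space_pre_sigma)
  define C where "C k = (A k \<inter> E) \<union> (A' k \<inter> (space M - E))" for k
  define D where "D = (B \<inter> E) \<union> (B' \<inter> (space M - E))"
  have FT: "E \<in> sets (F T)"
  proof -
    have "{\<omega> \<in> E. \<tau> \<omega> \<le> T} = E"
      using sub \<tau> by (auto simp: Theta_def)
    then show ?thesis
      using sets_pre_sigmaD[OF stopping_time_Theta[OF \<tau>] E, of T] by simp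
  qed
  have "space M - E \<in> sets (F T)"
    using sets.compl_sets[OF FT] by (simp add: space_F)
  then have "D \<in> sets (F T)"
    unfolding D_def using A(2) A'(2) FT by blast
  moreover have "\<forall>k. C k \<in> sets (pre_sigma (\<theta> k))"
    unfolding C_def
    using Int[OF \<tau> A(1)[rule_format] A(3) A(4)[rule_format] A(6) E]
      Int[OF \<tau>' A'(1)[rule_format] A'(3) A'(4)[rule_format] A'(6) cE']
    by (intro allI sets.Un)
  moreover have "disjoint_family C"
    using A(3) A'(3) unfolding disjoint_family_on_def C_def by blast
  moreover have "\<forall>k. C k \<inter> D = {}"
    using A(4) A'(4) unfolding C_def D_def by blast
  moreover have "(\<Union>k. C k) \<union> D = space M"
  proof -
    have "(\<Union>k. C k) \<union> D =
        ((\<Union>k. A k) \<union> B) \<inter> E \<union> ((\<Union>k. A' k) \<union> B') \<inter> (space M - E)"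
      unfolding C_def D_def by auto
    then show ?thesis
      unfolding A(5) A'(5) using sub by auto
  qed
  moreover have "AE \<omega> in M. (if \<omega> \<in> E then \<tau> \<omega> else \<tau>' \<omega>) =
      (\<Sum>k. \<theta> k \<omega> * indicator (C k) \<omega>) + T * indicator D \<omega>"
    using A(6) A'(6) AE_space
  proof eventually_elim
    case (elim \<omega>)
    have "indicator (C k) \<omega> = (if \<omega> \<in> E then indicator (A k) \<omega> else indicator (A' k) \<omega> :: real)"
      "indicator D \<omega> = (if \<omega> \<in> E then indicator B \<omega> else indicator B' \<omega> :: real)" for k
      using elim(3) by (auto simp: C_def D_def indicator_def)
    then show ?case
      using elim by simp
  qed
  moreover have "stopping_time F (\<lambda>\<omega>. if \<omega> \<in> E then \<tau> \<omega> else \<tau>' \<omega>)"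
  proof
    fix t
    have "{\<omega> \<in> E. \<tau> \<omega> \<le> t} \<union> {\<omega> \<in> space M - E. \<tau>' \<omega> \<le> t} \<in> sets (F t)"
      using sets_pre_sigmaD[OF stopping_time_Theta[OF \<tau>] E]
        sets_pre_sigmaD[OF stopping_time_Theta[OF \<tau>'] cE'] by (intro sets.Un)
    moreover have "{\<omega> \<in> space (F t). (if \<omega> \<in> E then \<tau> \<omega> else \<tau>' \<omega>) \<le> t} =
        {\<omega> \<in> E. \<tau> \<omega> \<le> t} \<union> {\<omega> \<in> space M - E. \<tau>' \<omega> \<le> t}"
      using sub by (auto simp: space_F)
    ultimately show "Measurable.pred (F t) (\<lambda>\<omega>. (if \<omega> \<in> E then \<tau> \<omega> else \<tau>' \<omega>) \<le> t)"
      by (simp add: pred_def)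
  qed
  moreover have "\<forall>\<omega>\<in>space M. (if \<omega> \<in> E then \<tau> \<omega> else \<tau>' \<omega>) \<in> {0..T}"
    using \<tau> \<tau>' by (simp add: Theta_def)
  ultimately show ?thesis
    unfolding Theta_def by (intro CollectI conjI exI[of _ C] exI[of _ D])
qed

lemma Theta_from_self: "\<tau> \<in> Theta \<Longrightarrow> \<tau> \<in> Theta_from \<tau>"
  by (simp add: Theta_from_def)

text \<open>Both times are almost surely at least \<open>\<nu>\<close>, so an event known at
  \<open>\<nu>\<close> is known at each of them and pasting along it is permitted.\<close>

lemma Theta_from_paste:
  assumes "\<nu> \<in> Theta" "\<tau> \<in> Theta_from \<nu>" "\<tau>' \<in> Theta_from \<nu>" "E \<in> sets (pre_sigma \<nu>)"
  shows "(\<lambda>\<omega>. if \<omega> \<in> E then \<tau> \<omega> else \<tau>' \<omega>) \<in> Theta_from \<nu>"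
proof -
  have "E \<in> sets (pre_sigma \<kappa>)" if "\<kappa> \<in> Theta_from \<nu>" for \<kappa>
    using that assms(1,4)
    by (intro sets_pre_sigma_mono_AE[of \<nu> \<kappa>]) (auto simp: Theta_from_def bounded_stopping_time_Theta)
  then have "(\<lambda>\<omega>. if \<omega> \<in> E then \<tau> \<omega> else \<tau>' \<omega>) \<in> Theta"
    using assms by (intro paste_in_Theta) (auto simp: Theta_from_def)
  moreover have "AE \<omega> in M. \<nu> \<omega> \<le> (if \<omega> \<in> E then \<tau> \<omega> else \<tau>' \<omega>)"
    using assms(2,3) unfolding Theta_from_def by auto
  ultimately show ?thesis
    by (simp add: Theta_from_def)
qed

lemma borel_measurable_pre_sigmaD:
  assumes "\<tau> \<in> Theta" "f \<in> borel_measurable (pre_sigma \<tau>)"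
  shows "f \<in> borel_measurable M"
  using assms(2) sets_pre_sigma_subset[OF bounded_stopping_time_Theta[OF assms(1)]]
  by (intro measurable_from_subalg[of M "pre_sigma \<tau>"]) (auto simp: subalgebra_def space_pre_sigma)

section \<open>The value family\<close>

lemma family_in_Lp_at:
  "admissible_family \<phi> \<Longrightarrow> p_integrable_family \<phi> \<Longrightarrow> \<tau> \<in> Theta \<Longrightarrow> \<phi> \<tau> \<in> Lp_at \<tau>"
  by (simp add: admissible_family_def p_integrable_family_def Lp_at_def)

lemma operator_in_Lp_at:
  "operator_family \<rho> \<Longrightarrow> S \<in> Theta \<Longrightarrow> \<tau> \<in> Theta \<Longrightarrow> \<eta> \<in> Lp_at \<tau> \<Longrightarrow> \<rho> S \<tau> \<eta> \<in> Lp_at S"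
  by (simp add: operator_family_def)

lemma zero_one_lawD:
  assumes "zero_one_law \<rho>" "admissible_family \<zeta>" "p_integrable_family \<zeta>" "S \<in> Theta"
    and "A \<in> sets (pre_sigma S)" "\<tau> \<in> Theta_from S" "\<tau>' \<in> Theta_from S"
    and "AE \<omega> in M. \<omega> \<in> A \<longrightarrow> \<tau> \<omega> = \<tau>' \<omega>"
  shows "AE \<omega> in M. \<omega> \<in> A \<longrightarrow> \<rho> S \<tau> (\<zeta> \<tau>) \<omega> = \<rho> S \<tau>' (\<zeta> \<tau>') \<omega>"
proof -
  have "AE \<omega> in M. indicator A \<omega> * \<rho> S \<tau> (\<zeta> \<tau>) \<omega> = indicator A \<omega> * \<rho> S \<tau>' (\<zeta> \<tau>') \<omega>"
    using assms unfolding zero_one_law_def by blast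
  then show ?thesis
    by (rule AE_mp) (auto simp: indicator_def)
qed

lemma value_upper:
  assumes "is_value_family \<rho> \<xi> V" "\<nu> \<in> Theta" "\<tau> \<in> Theta_from \<nu>"
  shows "AE \<omega> in M. \<rho> \<nu> \<tau> (\<xi> \<tau>) \<omega> \<le> V \<nu> \<omega>"
  using assms unfolding is_value_family_def is_ess_sup_def by auto

lemma value_least:
  assumes "is_value_family \<rho> \<xi> V" "\<nu> \<in> Theta" "Z \<in> borel_measurable M"
    and "\<And>\<tau>. \<tau> \<in> Theta_from \<nu> \<Longrightarrow> AE \<omega> in M. ereal (\<rho> \<nu> \<tau> (\<xi> \<tau>) \<omega>) \<le> Z \<omega>"
  shows "AE \<omega> in M. ereal (V \<nu> \<omega>) \<le> Z \<omega>"
  using assms unfolding is_value_family_def is_ess_sup_def by auto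

text \<open>Instance of \<open>directed_ess_sup_sequence\<close>, with directedness supplied by
  pasting and the zero-one law.\<close>

lemma value_sequence:
  assumes \<rho>: "operator_family \<rho>" and zero_one: "zero_one_law \<rho>"
    and \<xi>: "admissible_family \<xi>" "p_integrable_family \<xi>"
    and V: "is_value_family \<rho> \<xi> V" and \<nu>: "\<nu> \<in> Theta"
  obtains \<kappa> :: "nat \<Rightarrow> 'a \<Rightarrow> real" where "\<And>n. \<kappa> n \<in> Theta_from \<nu>"
    and "\<And>n. AE \<omega> in M. \<rho> \<nu> (\<kappa> n) (\<xi> (\<kappa> n)) \<omega> \<le> \<rho> \<nu> (\<kappa> (Suc n)) (\<xi> (\<kappa> (Suc n))) \<omega>"
    and "AE \<omega> in M. (\<lambda>n. \<rho> \<nu> (\<kappa> n) (\<xi> (\<kappa> n)) \<omega>) \<longlonglongrightarrow> V \<nu> \<omega>"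
proof (rule directed_ess_sup_sequence[of "Theta_from \<nu>" "\<lambda>\<kappa>. \<rho> \<nu> \<kappa> (\<xi> \<kappa>)" "V \<nu>"])
  have measurable: "\<rho> \<nu> \<kappa> (\<xi> \<kappa>) \<in> borel_measurable (pre_sigma \<nu>)" if "\<kappa> \<in> Theta_from \<nu>" for \<kappa>
    using operator_in_Lp_at[OF \<rho> \<nu> _ family_in_Lp_at[OF \<xi>]] that
    by (auto simp: Theta_from_def Lp_at_def)
  show "Theta_from \<nu> \<noteq> {}"
    using Theta_from_self[OF \<nu>] by blast
  show "\<rho> \<nu> \<kappa> (\<xi> \<kappa>) \<in> borel_measurable M" if "\<kappa> \<in> Theta_from \<nu>" for \<kappa>
    using measurable[OF that] by (rule borel_measurable_pre_sigmaD[OF \<nu>])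
  show "is_ess_sup M (Theta_from \<nu>) (\<lambda>\<tau> \<omega>. ereal (\<rho> \<nu> \<tau> (\<xi> \<tau>) \<omega>)) (\<lambda>\<omega>. ereal (V \<nu> \<omega>))"
    using V \<nu> by (simp add: is_value_family_def)
  fix \<tau> \<tau>' assume \<tau>: "\<tau> \<in> Theta_from \<nu>" and \<tau>': "\<tau>' \<in> Theta_from \<nu>"
  \<comment> \<open>\<open>\<kappa>\<close> follows the better of the two times, ties going to
    \<open>\<tau>\<close>. The zero-one law, used on \<open>A\<close> and on its complement,
    identifies the value of \<open>\<kappa>\<close> with the larger one.\<close>
  define A where "A = {\<omega> \<in> space (pre_sigma \<nu>). \<rho> \<nu> \<tau>' (\<xi> \<tau>') \<omega> \<le> \<rho> \<nu> \<tau> (\<xi> \<tau>) \<omega>}"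
  define \<kappa> where "\<kappa> = (\<lambda>\<omega>. if \<omega> \<in> A then \<tau> \<omega> else \<tau>' \<omega>)"
  have A: "A \<in> sets (pre_sigma \<nu>)"
    unfolding A_def using measurable[OF \<tau>] measurable[OF \<tau>'] by measurable
  then have A': "space M - A \<in> sets (pre_sigma \<nu>)"
    using sets.compl_sets[OF A] by (simp add: space_pre_sigma)
  have \<kappa>: "\<kappa> \<in> Theta_from \<nu>"
    unfolding \<kappa>_def using Theta_from_paste[OF \<nu> \<tau> \<tau>' A] .
  have "AE \<omega> in M. \<omega> \<in> A \<longrightarrow> \<rho> \<nu> \<kappa> (\<xi> \<kappa>) \<omega> = \<rho> \<nu> \<tau> (\<xi> \<tau>) \<omega>"
    using zero_one_lawD[OF zero_one \<xi> \<nu> A \<kappa> \<tau>] by (simp add: \<kappa>_def)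
  moreover have "AE \<omega> in M. \<omega> \<in> space M - A \<longrightarrow> \<rho> \<nu> \<kappa> (\<xi> \<kappa>) \<omega> = \<rho> \<nu> \<tau>' (\<xi> \<tau>') \<omega>"
    using zero_one_lawD[OF zero_one \<xi> \<nu> A' \<kappa> \<tau>'] by (simp add: \<kappa>_def)
  ultimately have "AE \<omega> in M. max (\<rho> \<nu> \<tau> (\<xi> \<tau>) \<omega>) (\<rho> \<nu> \<tau>' (\<xi> \<tau>') \<omega>) \<le> \<rho> \<nu> \<kappa> (\<xi> \<kappa>) \<omega>"
    using AE_space by eventually_elim (auto simp: A_def space_pre_sigma)
  then show "\<exists>\<kappa>\<in>Theta_from \<nu>.
      AE \<omega> in M. max (\<rho> \<nu> \<tau> (\<xi> \<tau>) \<omega>) (\<rho> \<nu> \<tau>' (\<xi> \<tau>') \<omega>) \<le> \<rho> \<nu> \<kappa> (\<xi> \<kappa>) \<omega>"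
    using \<kappa> by blast
qed (rule that)

text \<open>An essential supremum is a priori only \<open>M\<close>-measurable. Here it is an almost
  sure limit of a sequence measurable at \<open>\<nu>\<close>, and the null sets belong to
  \<open>pre_sigma \<nu>\<close>.\<close>

lemma value_measurable:
  assumes "operator_family \<rho>" "zero_one_law \<rho>" and \<xi>: "admissible_family \<xi>" "p_integrable_family \<xi>"
    and "is_value_family \<rho> \<xi> V" and \<nu>: "\<nu> \<in> Theta"
  shows "V \<nu> \<in> borel_measurable (pre_sigma \<nu>)"
proof -
  obtain \<kappa> where \<kappa>: "\<And>n. \<kappa> n \<in> Theta_from \<nu>"
    and lim: "AE \<omega> in M. (\<lambda>n. \<rho> \<nu> (\<kappa> n) (\<xi> (\<kappa> n)) \<omega>) \<longlonglongrightarrow> V \<nu> \<omega>"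
    using value_sequence[OF assms] by blast
  have "\<rho> \<nu> (\<kappa> n) (\<xi> (\<kappa> n)) \<in> borel_measurable (pre_sigma \<nu>)" for n
    using operator_in_Lp_at[OF assms(1) \<nu> _ family_in_Lp_at[OF \<xi>]] \<kappa>[of n]
    by (auto simp: Theta_from_def Lp_at_def)
  then have "(\<lambda>\<omega>. lim (\<lambda>n. \<rho> \<nu> (\<kappa> n) (\<xi> (\<kappa> n)) \<omega>)) \<in> borel_measurable (pre_sigma \<nu>)"
    by (rule borel_measurable_lim_metric)
  moreover have "AE \<omega> in M. lim (\<lambda>n. \<rho> \<nu> (\<kappa> n) (\<xi> (\<kappa> n)) \<omega>) = V \<nu> \<omega>"
    using lim by eventually_elim (rule limI)
  ultimately show ?thesis
    using null_sets_subset_pre_sigma[OF bounded_stopping_time_Theta[OF \<nu>]]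
    by (auto simp: space_pre_sigma intro: measurable_cong_AE_subalgebra[of "pre_sigma \<nu>"])
qed

text \<open>One half of the admissibility of \<open>V\<close>: on the event where the two times
  agree, every competitor for \<open>\<nu>\<close> can be traded for one that also competes for
  \<open>\<nu>'\<close> and has the same value there.\<close>

lemma value_le_on_eq_set:
  assumes adm: "op_admissible \<rho>" and zero_one: "zero_one_law \<rho>"
    and \<xi>: "admissible_family \<xi>" "p_integrable_family \<xi>" and V: "is_value_family \<rho> \<xi> V"
    and \<nu>: "\<nu> \<in> Theta" and \<nu>': "\<nu>' \<in> Theta" and V': "V \<nu>' \<in> borel_measurable M"
  shows "AE \<omega> in M. \<nu> \<omega> = \<nu>' \<omega> \<longrightarrow> V \<nu> \<omega> \<le> V \<nu>' \<omega>"
proof -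
  define A where "A = {\<omega> \<in> space M. \<nu> \<omega> = \<nu>' \<omega>}"
  have A: "A \<in> sets (pre_sigma \<nu>)"
    unfolding A_def by (intro eq_set_pre_sigma stopping_time_Theta \<nu> \<nu>')
  then have AM: "A \<in> sets M"
    using sets_pre_sigma_subset[OF bounded_stopping_time_Theta[OF \<nu>]] by blast
  \<comment> \<open>The value infinity makes the bound trivial off \<open>A\<close>; the essential
    supremum is least among extended real-valued bounds, so such a \<open>Z\<close> is
    legitimate.\<close>
  define Z where "Z \<omega> = (if \<omega> \<in> A then ereal (V \<nu>' \<omega>) else \<infinity>)" for \<omega>
  have "AE \<omega> in M. ereal (V \<nu> \<omega>) \<le> Z \<omega>"
  proof (rule value_least[OF V \<nu>])
    show "Z \<in> borel_measurable M"
      unfolding Z_def using AM V' by measurable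
    fix \<tau> assume \<tau>: "\<tau> \<in> Theta_from \<nu>"
    \<comment> \<open>Off \<open>A\<close> the time \<open>\<tau>\<close> may lie below
      \<open>\<nu>'\<close>. Replacing it there by \<open>T\<close> gives a time above both, and the
      zero-one law shows that its value is unchanged on \<open>A\<close>.\<close>
    define \<kappa> where "\<kappa> = (\<lambda>\<omega>. if \<omega> \<in> A then \<tau> \<omega> else T)"
    have "(\<lambda>_. T) \<in> Theta_from \<nu>"
      using \<nu> const_in_Theta by (auto simp: Theta_from_def Theta_def)
    then have \<kappa>: "\<kappa> \<in> Theta_from \<nu>"
      unfolding \<kappa>_def using Theta_from_paste[OF \<nu> \<tau> _ A] by blast
    then have \<kappa>_Theta: "\<kappa> \<in> Theta" and "AE \<omega> in M. \<nu> \<omega> \<le> \<kappa> \<omega>"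
      by (auto simp: Theta_from_def)
    from this(2) have "AE \<omega> in M. \<nu>' \<omega> \<le> \<kappa> \<omega>"
      using AE_space by eventually_elim (use \<nu>' in \<open>auto simp: \<kappa>_def A_def Theta_def split: if_splits\<close>)
    then have "AE \<omega> in M. \<rho> \<nu>' \<kappa> (\<xi> \<kappa>) \<omega> \<le> V \<nu>' \<omega>"
      using \<kappa>_Theta by (intro value_upper[OF V \<nu>']) (auto simp: Theta_from_def)
    moreover have "AE \<omega> in M. \<nu> \<omega> = \<nu>' \<omega> \<longrightarrow> \<rho> \<nu> \<kappa> (\<xi> \<kappa>) \<omega> = \<rho> \<nu>' \<kappa> (\<xi> \<kappa>) \<omega>"
      using adm \<nu> \<nu>' \<kappa>_Theta family_in_Lp_at[OF \<xi> \<kappa>_Theta] unfolding op_admissible_def by blast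
    moreover have "AE \<omega> in M. \<omega> \<in> A \<longrightarrow> \<rho> \<nu> \<tau> (\<xi> \<tau>) \<omega> = \<rho> \<nu> \<kappa> (\<xi> \<kappa>) \<omega>"
      using zero_one_lawD[OF zero_one \<xi> \<nu> A \<tau> \<kappa>] by (simp add: \<kappa>_def)
    ultimately show "AE \<omega> in M. ereal (\<rho> \<nu> \<tau> (\<xi> \<tau>) \<omega>) \<le> Z \<omega>"
      by eventually_elim (auto simp: Z_def A_def)
  qed
  then show ?thesis
    using AE_space by eventually_elim (auto simp: Z_def A_def)
qed

text \<open>Admissibility combines \<open>value_measurable\<close> with
  \<open>value_le_on_eq_set\<close> used in both directions; the inequality comes from the
  approximating sequence at the later time \<open>\<tau>\<close>.\<close>

lemma value_supermartingale:
  assumes \<rho>: "operator_family \<rho>" and \<xi>: "admissible_family \<xi>" "p_integrable_family \<xi>"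
    and V: "is_value_family \<rho> \<xi> V" and Lp: "\<forall>\<nu>\<in>Theta. V \<nu> \<in> Lp M p"
    and adm: "op_admissible \<rho>" and cons: "op_consistent \<rho>"
    and zero_one: "zero_one_law \<rho>" and Fatou: "monotone_Fatou \<rho>"
  shows "supermartingale_family \<rho> V"
proof -
  have meas: "V \<nu> \<in> borel_measurable (pre_sigma \<nu>)" if "\<nu> \<in> Theta" for \<nu>
    using value_measurable[OF \<rho> zero_one \<xi> V that] .
  have V_le: "AE \<omega> in M. \<nu> \<omega> = \<nu>' \<omega> \<longrightarrow> V \<nu> \<omega> \<le> V \<nu>' \<omega>" if "\<nu> \<in> Theta" "\<nu>' \<in> Theta" for \<nu> \<nu>'
    using value_le_on_eq_set[OF adm zero_one \<xi> V that] Lp that by (auto simp: Lp_def)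
  have V_eq: "AE \<omega> in M. \<nu> \<omega> = \<nu>' \<omega> \<longrightarrow> V \<nu> \<omega> = V \<nu>' \<omega>" if "\<nu> \<in> Theta" "\<nu>' \<in> Theta" for \<nu> \<nu>'
    using V_le[OF that] V_le[OF that(2,1)] by eventually_elim auto
  have "AE \<omega> in M. \<rho> \<sigma> \<tau> (V \<tau>) \<omega> \<le> V \<sigma> \<omega>"
    if \<sigma>: "\<sigma> \<in> Theta" and \<tau>: "\<tau> \<in> Theta" and le: "AE \<omega> in M. \<sigma> \<omega> \<le> \<tau> \<omega>" for \<sigma> \<tau>
  proof -
    obtain \<kappa> where \<kappa>: "\<And>n. \<kappa> n \<in> Theta_from \<tau>"
      and mono: "\<And>n. AE \<omega> in M. \<rho> \<tau> (\<kappa> n) (\<xi> (\<kappa> n)) \<omega> \<le> \<rho> \<tau> (\<kappa> (Suc n)) (\<xi> (\<kappa> (Suc n))) \<omega>"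
      and lim: "AE \<omega> in M. (\<lambda>n. \<rho> \<tau> (\<kappa> n) (\<xi> (\<kappa> n)) \<omega>) \<longlonglongrightarrow> V \<tau> \<omega>"
      using value_sequence[OF \<rho> zero_one \<xi> V \<tau>] by blast
    define \<eta> where "\<eta> n = \<rho> \<tau> (\<kappa> n) (\<xi> (\<kappa> n))" for n
    have \<kappa>_Theta: "\<kappa> n \<in> Theta" and \<kappa>_ge: "AE \<omega> in M. \<tau> \<omega> \<le> \<kappa> n \<omega>" for n
      using \<kappa>[of n] by (auto simp: Theta_from_def)
    have \<eta>: "\<eta> n \<in> Lp_at \<tau>" for n
      unfolding \<eta>_def using operator_in_Lp_at[OF \<rho> \<tau> \<kappa>_Theta family_in_Lp_at[OF \<xi> \<kappa>_Theta]] .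
    have VLp: "V \<tau> \<in> Lp_at \<tau>"
      using meas[OF \<tau>] Lp \<tau> by (simp add: Lp_at_def)
    have "AE \<omega> in M. \<forall>n. \<eta> n \<omega> \<le> \<eta> (Suc n) \<omega>"
      using mono by (subst AE_all_countable) (auto simp: \<eta>_def)
    \<comment> \<open>The Fatou property asks for the real supremum of the sequence to be in
      \<open>Lp M p\<close>. Convergence bounds the sequence almost surely, so this supremum is its
      limit \<open>V \<tau>\<close>, which is in \<open>Lp M p\<close> by assumption.\<close>
    then have sup: "AE \<omega> in M. V \<tau> \<omega> = (SUP n. \<eta> n \<omega>)"
      using lim
    proof eventually_elim
      case (elim \<omega>)
      then have inc: "incseq (\<lambda>n. \<eta> n \<omega>)"
        by (intro incseq_SucI) auto
      have conv: "(\<lambda>n. \<eta> n \<omega>) \<longlonglongrightarrow> V \<tau> \<omega>"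
        using elim(2) by (simp add: \<eta>_def)
      have "bdd_above (range (\<lambda>n. \<eta> n \<omega>))"
        using incseq_le[OF inc conv] by (auto simp: bdd_above_def)
      then have "(\<lambda>n. \<eta> n \<omega>) \<longlonglongrightarrow> (SUP n. \<eta> n \<omega>)"
        using inc by (rule LIMSEQ_incseq_SUP)
      then show ?case
        using conv LIMSEQ_unique by blast
    qed
    have "V \<tau> \<in> borel_measurable M"
      using Lp \<tau> by (auto simp: Lp_def)
    then have "(\<lambda>\<omega>. SUP n. \<eta> n \<omega>) \<in> borel_measurable M"
      using sup by (rule measurable_cong_AE_subalgebra[OF refl, rotated 1]) auto
    then have "(\<lambda>\<omega>. SUP n. \<eta> n \<omega>) \<in> Lp M p"
      using Lp \<tau> sup by (auto intro: Lp_cong_AE[of "V \<tau>"])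
    moreover have "\<forall>n. AE \<omega> in M. \<eta> n \<omega> \<le> \<eta> (Suc n) \<omega>" "AE \<omega> in M. (\<lambda>n. \<eta> n \<omega>) \<longlonglongrightarrow> V \<tau> \<omega>"
      using mono lim by (auto simp: \<eta>_def)
    ultimately have fatou:
      "AE \<omega> in M. ereal (\<rho> \<sigma> \<tau> (V \<tau>) \<omega>) \<le> liminf (\<lambda>n. ereal (\<rho> \<sigma> \<tau> (\<eta> n) \<omega>))"
      using Fatou \<sigma> \<tau> VLp \<eta> unfolding monotone_Fatou_def by blast
    \<comment> \<open>Consistency collapses the two evaluations into one from
      \<open>\<kappa> n\<close> to \<open>\<sigma>\<close>, and \<open>\<kappa> n\<close> is a
      competitor for \<open>\<sigma>\<close>. The bound is free of \<open>n\<close> and hence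
      survives the limes inferior.\<close>
    have "AE \<omega> in M. \<rho> \<sigma> \<tau> (\<eta> n) \<omega> \<le> V \<sigma> \<omega>" for n
    proof -
      have "AE \<omega> in M. \<rho> \<sigma> \<tau> (\<eta> n) \<omega> = \<rho> \<sigma> (\<kappa> n) (\<xi> (\<kappa> n)) \<omega>"
        using cons \<sigma> \<tau> \<kappa>_Theta family_in_Lp_at[OF \<xi> \<kappa>_Theta] le \<kappa>_ge
        unfolding op_consistent_def \<eta>_def by blast
      moreover have "AE \<omega> in M. \<sigma> \<omega> \<le> \<kappa> n \<omega>"
        using le \<kappa>_ge[of n] by eventually_elim auto
      then have "AE \<omega> in M. \<rho> \<sigma> (\<kappa> n) (\<xi> (\<kappa> n)) \<omega> \<le> V \<sigma> \<omega>"
        using \<kappa>_Theta by (intro value_upper[OF V \<sigma>]) (auto simp: Theta_from_def)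
      ultimately show ?thesis
        by eventually_elim auto
    qed
    then have "AE \<omega> in M. \<forall>n. \<rho> \<sigma> \<tau> (\<eta> n) \<omega> \<le> V \<sigma> \<omega>"
      by (subst AE_all_countable) auto
    with fatou show ?thesis
    proof eventually_elim
      case (elim \<omega>)
      have "liminf (\<lambda>n. ereal (\<rho> \<sigma> \<tau> (\<eta> n) \<omega>)) \<le> liminf (\<lambda>n. ereal (V \<sigma> \<omega>))"
        using elim(2) by (intro Liminf_mono) auto
      also have "\<dots> = ereal (V \<sigma> \<omega>)"
        by (simp add: Liminf_const)
      finally show ?case
        using elim(1) by (metis ereal_less_eq(3) order_trans)
    qed
  qed
  then show ?thesis
    using meas V_eq Lp
    by (simp add: supermartingale_family_def admissible_family_def p_integrable_family_def)
qed

section \<open>Domination and minimality\<close>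

text \<open>Stopping at once is allowed: \<open>\<tau>\<close> competes in its own essential
  supremum, and knowledge preservation makes its value \<open>\<xi> \<tau>\<close>.\<close>

lemma value_dominates:
  assumes \<xi>: "admissible_family \<xi>" "p_integrable_family \<xi>"
    and V: "is_value_family \<rho> \<xi> V" and know: "knowledge_preserving \<rho>"
  shows "dominates V \<xi>"
  unfolding dominates_def
proof
  fix \<tau> assume \<tau>: "\<tau> \<in> Theta"
  have "AE \<omega> in M. \<rho> \<tau> \<tau> (\<xi> \<tau>) \<omega> = \<xi> \<tau> \<omega>"
    using know \<tau> Theta_from_self[OF \<tau>] family_in_Lp_at[OF \<xi> \<tau>]
    unfolding knowledge_preserving_def by blast
  then show "AE \<omega> in M. \<xi> \<tau> \<omega> \<le> V \<tau> \<omega>"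
    using value_upper[OF V \<tau> Theta_from_self[OF \<tau>]] by eventually_elim auto
qed

text \<open>Monotonicity and the supermartingale inequality put every competing value below
  \<open>\<phi> \<nu>\<close>, so \<open>\<phi> \<nu>\<close> is an upper bound to which leastness
  of the essential supremum applies.\<close>

lemma dominates_value:
  assumes \<xi>: "admissible_family \<xi>" "p_integrable_family \<xi>"
    and V: "is_value_family \<rho> \<xi> V" and mono: "op_monotone \<rho>"
    and \<phi>: "supermartingale_family \<rho> \<phi>" and dom: "dominates \<phi> \<xi>"
  shows "dominates \<phi> V"
  unfolding dominates_def
proof
  fix \<nu> assume \<nu>: "\<nu> \<in> Theta"
  have \<phi>': "admissible_family \<phi>" "p_integrable_family \<phi>"
    using \<phi> by (auto simp: supermartingale_family_def)
  have "AE \<omega> in M. ereal (V \<nu> \<omega>) \<le> ereal (\<phi> \<nu> \<omega>)"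
  proof (rule value_least[OF V \<nu>])
    have "\<phi> \<nu> \<in> borel_measurable M"
      using \<phi>'(2) \<nu> by (auto simp: p_integrable_family_def Lp_def)
    then show "(\<lambda>\<omega>. ereal (\<phi> \<nu> \<omega>)) \<in> borel_measurable M"
      by measurable
    fix \<tau> assume "\<tau> \<in> Theta_from \<nu>"
    then have \<tau>: "\<tau> \<in> Theta" "AE \<omega> in M. \<nu> \<omega> \<le> \<tau> \<omega>"
      by (auto simp: Theta_from_def)
    have "AE \<omega> in M. \<xi> \<tau> \<omega> \<le> \<phi> \<tau> \<omega>"
      using dom \<tau>(1) by (simp add: dominates_def)
    then have "AE \<omega> in M. \<rho> \<nu> \<tau> (\<xi> \<tau>) \<omega> \<le> \<rho> \<nu> \<tau> (\<phi> \<tau>) \<omega>"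
      using mono \<nu> \<tau>(1) family_in_Lp_at[OF \<xi> \<tau>(1)] family_in_Lp_at[OF \<phi>' \<tau>(1)]
      unfolding op_monotone_def by blast
    moreover have "AE \<omega> in M. \<rho> \<nu> \<tau> (\<phi> \<tau>) \<omega> \<le> \<phi> \<nu> \<omega>"
      using \<phi> \<nu> \<tau> by (simp add: supermartingale_family_def)
    ultimately show "AE \<omega> in M. ereal (\<rho> \<nu> \<tau> (\<xi> \<tau>) \<omega>) \<le> ereal (\<phi> \<nu> \<omega>)"
      by eventually_elim auto
  qed
  then show "AE \<omega> in M. V \<nu> \<omega> \<le> \<phi> \<nu> \<omega>"
    by simp
qed

end

theorem theorem2p1:
  fixes M :: "'a measure" and F :: "real \<Rightarrow> 'a measure" and T :: real
    and \<theta> :: "nat \<Rightarrow> 'a \<Rightarrow> real" and p :: ereal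
    and \<rho> :: "('a \<Rightarrow> real) \<Rightarrow> ('a \<Rightarrow> real) \<Rightarrow> ('a \<Rightarrow> real) \<Rightarrow> 'a \<Rightarrow> real"
    and \<xi> V :: "('a \<Rightarrow> real) \<Rightarrow> 'a \<Rightarrow> real"
  assumes "stopping_setting M F T \<theta> p"
    and "stopping_setting.operator_family M F T \<theta> p \<rho>"
    and "stopping_setting.admissible_family M F T \<theta> \<xi>"
    and "stopping_setting.p_integrable_family M F T \<theta> p \<xi>"
    and "stopping_setting.is_value_family M F T \<theta> \<rho> \<xi> V"
    and "\<forall>\<nu>\<in>stopping_setting.Theta M F T \<theta>. V \<nu> \<in> Lp M p"
  shows "(stopping_setting.op_admissible M F T \<theta> p \<rho> \<and>
          stopping_setting.op_consistent M F T \<theta> p \<rho> \<and>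
          stopping_setting.zero_one_law M F T \<theta> p \<rho> \<and>
          stopping_setting.monotone_Fatou M F T \<theta> p \<rho>
            \<longrightarrow> stopping_setting.supermartingale_family M F T \<theta> p \<rho> V) \<and>
         (stopping_setting.op_admissible M F T \<theta> p \<rho> \<and>
          stopping_setting.op_consistent M F T \<theta> p \<rho> \<and>
          stopping_setting.zero_one_law M F T \<theta> p \<rho> \<and>
          stopping_setting.monotone_Fatou M F T \<theta> p \<rho> \<and>
          stopping_setting.knowledge_preserving M F T \<theta> p \<rho> \<and>
          stopping_setting.op_monotone M F T \<theta> p \<rho>
            \<longrightarrow> stopping_setting.is_Snell_envelope M F T \<theta> p \<rho> \<xi> V)"
proof -
  interpret stopping_setting M F T \<theta> p
    by (rule assms(1))
  show ?thesis
    using value_supermartingale[OF assms(2-6)] value_dominates[OF assms(3-5)]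
      dominates_value[OF assms(3-5)]
    unfolding is_Snell_envelope_def by blast
qed

end
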